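(* Let $d\ge 1$ and let $\mathcal{F}=\{K_1,\dots,K_{d+1}\}$ be a well separated family of convex bodies in $\mathbb{R}^d$, and let $\alpha=(\alpha_1,\dots,\alpha_{d+1})\in[0,1]^{d+1}$. Then there exists a unique Euclidean sphere $S(x,r)$ which is transversal to $\mathcal{F}$ and satisfies $\mathrm{Vol}(B(x,r)\cap K_i)=\alpha_i\cdot\mathrm{Vol}(K_i)$ for every $i\in\{1,\dots,d+1\}$.
   Context: A convex body in $\mathbb{R}^d$ is a compact convex set with nonempty interior. A family $\mathcal{F}$ of connected sets in $\mathbb{R}^d$ is well separated if for any $k\le d+1$ distinct members $K_1,\dots,K_k$ of $\mathcal{F}$ and any choice of points $x_i\in\mathrm{conv}\,K_i$ ($i=1,\dots,k$), the affine hull $\mathrm{aff}\{x_1,\dots,x_k\}$ is a $(k-1)$-dimensional flat. $B(x,r)$ and $S(x,r)$ denote the closed Euclidean ball and the sphere of center $x$ and radius $r>0$. A sphere is transversal to a family of sets if it intersects every member of the family. $\mathrm{Vol}$ denotes $d$-dimensional Lebesgue measure. *)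

theory Defs
  imports "HOL-Analysis.Analysis"
begin

definition convex_body :: "'a::euclidean_space set \<Rightarrow> bool" where
  "convex_body K \<longleftrightarrow> compact K \<and> convex K \<and> interior K \<noteq> {}"

text \<open>A family is a set of sets, so distinct members are listed by an injective \<open>C\<close>.
  The case \<open>k = 0\<close> holds trivially, because the empty set has affine dimension \<open>-1\<close>.\<close>

definition well_separated :: "'a::euclidean_space set set \<Rightarrow> bool" where
  "well_separated F \<longleftrightarrow>
     (\<forall>K\<in>F. connected K) \<and>
     (\<forall>k C x. k \<le> DIM('a) + 1 \<longrightarrow> inj_on C {1..k} \<longrightarrow> C ` {1..k} \<subseteq> F \<longrightarrow>
        (\<forall>i\<in>{1..k}. x i \<in> convex hull (C i)) \<longrightarrow>
        aff_dim (affine hull (x ` {1..k})) = int k - 1)"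

definition transversal :: "'a set \<Rightarrow> 'a set set \<Rightarrow> bool" where
  "transversal S F \<longleftrightarrow> (\<forall>K\<in>F. S \<inter> K \<noteq> {})"

end

theory Submission imports Defs "HOL-Probability.Distribution_Functions" begin

text \<open>Spheres correspond to functions \<open>z \<mapsto> z \<bullet> z - p \<bullet> (z, 1)\<close> with \<open>p\<close> in
  \<open>'a \<times> real\<close>, a space of dimension \<open>d + 1\<close>. For each \<open>i\<close> let \<open>h i p\<close> be the
  \<open>\<alpha> i\<close>-quantile of such a function on \<open>K i\<close>, chosen among its values on \<open>K i\<close>; the sphere is
  the required one iff \<open>h i p = 0\<close> for all \<open>i\<close>. By connectedness of \<open>K i\<close>, two functions shifted
  by their quantiles agree somewhere on \<open>K i\<close>, whence \<open>h i p - h i q = (q - p) \<bullet> (z, 1)\<close> for some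
  \<open>z \<in> K i\<close>. Since \<open>d + 1\<close> points chosen from the \<open>K i\<close> are affinely independent, this makes
  \<open>h\<close> injective, and bi-Lipschitz by compactness. So the image of \<open>h\<close> is closed, it is open by
  invariance of domain, and \<open>h\<close> takes the value \<open>0\<close> exactly once.\<close>

section \<open>Quantiles of continuous functions on a convex body\<close>

text \<open>Otherwise \<open>{v \<le> t}\<close> lies in \<open>{u \<le> s}\<close> with equal
  measure, while the difference contains a nonempty open set.\<close>

lemma quantile_superlevel:
  fixes K :: "'a::euclidean_space set" and u v :: "'a \<Rightarrow> real"
  assumes K: "convex_body K" and u: "continuous_on K u" and v: "continuous_on K v"
    and s: "s \<in> u ` K" and t: "t \<in> v ` K"
    and eq: "measure lebesgue {z\<in>K. u z \<le> s} = measure lebesgue {z\<in>K. v z \<le> t}"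
  shows "\<exists>z\<in>K. v z - t \<le> u z - s"
proof (rule ccontr)
  assume "\<not> ?thesis"
  then have less: "u z - s < v z - t" if "z \<in> K" for z using that by force
  have cK: "compact K" "convex K" "interior K \<noteq> {}" using K by (auto simp: convex_body_def)
  obtain z1 z2 where z: "z1 \<in> K" "v z1 = t" "z2 \<in> K" "u z2 = s" using s t by auto
  \<comment> \<open>The sum is negative where \<open>v = t\<close> and positive where
    \<open>u = s\<close>. At a zero of it, the assumed inequality forces \<open>u < s\<close> and
    \<open>t < v\<close>.\<close>
  have "connected ((\<lambda>z. (u z - s) + (v z - t)) ` K)"
    by (intro connected_continuous_image continuous_intros u v convex_connected cK)
  moreover have "(u z1 - s) + (v z1 - t) \<le> 0" "0 \<le> (u z2 - s) + (v z2 - t)"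
    using less[of z1] less[of z2] z by auto
  ultimately have "0 \<in> (\<lambda>z. (u z - s) + (v z - t)) ` K"
    using z by (blast intro: connectedD_interval)
  then obtain z where zK: "z \<in> K" and "(u z - s) + (v z - t) = 0" by auto
  then have z: "u z < s" "t < v z" using less[of z] by auto
  have lm: "{z\<in>K. w z \<le> c} \<in> lmeasurable" if "continuous_on K w" for w and c :: real
  proof -
    have "closed (K \<inter> w -` {..c})"
      by (intro continuous_closed_preimage that compact_imp_closed cK closed_atMost)
    then have "compact (K \<inter> (K \<inter> w -` {..c}))"
      using cK by (intro compact_Int_closed)
    moreover have "K \<inter> (K \<inter> w -` {..c}) = {z\<in>K. w z \<le> c}" by auto
    ultimately show ?thesis by (metis lmeasurable_compact)
  qed
  let ?D = "{z\<in>K. u z \<le> s} - {z\<in>K. v z \<le> t}"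
  have "{z\<in>K. v z \<le> t} \<subseteq> {z\<in>K. u z \<le> s}" using less by force
  then have "measure lebesgue ?D = 0"
    using lm u v eq by (subst measurable_measure_Diff) (auto simp: fmeasurableD)
  then have neg: "negligible ?D"
    using lm u v by (simp add: negligible_iff_measure fmeasurable.Diff)
  have "openin (top_of_set K) (K \<inter> u -` {..<s})" "openin (top_of_set K) (K \<inter> v -` {t<..})"
    using u v by (auto intro: continuous_openin_preimage_gen)
  then have "openin (top_of_set K) ((K \<inter> u -` {..<s}) \<inter> (K \<inter> v -` {t<..}))"
    by (rule openin_Int)
  then obtain U where U: "open U" "(K \<inter> u -` {..<s}) \<inter> (K \<inter> v -` {t<..}) = K \<inter> U"
    by (auto simp: openin_open)
  have "z \<in> U" using U zK z by blast
  \<comment> \<open>\<open>z\<close> may lie on the boundary of \<open>K\<close>, but its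
    neighbourhood \<open>U\<close> still meets the interior.\<close>
  moreover have "z \<in> closure (interior K)"
    using zK cK convex_closure_interior[of K] closure_subset by blast
  ultimately have "interior K \<inter> U \<noteq> {}"
    using U(1) by (metis Int_commute disjoint_iff open_Int_closure_eq_empty)
  moreover have "interior K \<inter> U \<subseteq> ?D"
  proof
    fix y assume y: "y \<in> interior K \<inter> U"
    then have "y \<in> (K \<inter> u -` {..<s}) \<inter> (K \<inter> v -` {t<..})"
      unfolding U(2) using interior_subset[of K] by blast
    then show "y \<in> ?D" by auto
  qed
  ultimately show False
    using neg U(1) open_not_negligible negligible_subset by (metis open_Int open_interior)
qed

text \<open>\<open>quantile_superlevel\<close>, applied both ways, gives points where the difference
  of the shifted functions is \<ge> 0 and \<le> 0; \<open>K\<close> is connected.\<close>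

lemma quantile_crossing:
  fixes K :: "'a::euclidean_space set" and u v :: "'a \<Rightarrow> real"
  assumes K: "convex_body K" and u: "continuous_on K u" and v: "continuous_on K v"
    and s: "s \<in> u ` K" and t: "t \<in> v ` K"
    and eq: "measure lebesgue {z\<in>K. u z \<le> s} = measure lebesgue {z\<in>K. v z \<le> t}"
  shows "\<exists>z\<in>K. u z - s = v z - t"
proof -
  obtain z1 z2 where z: "z1 \<in> K" "v z1 - t \<le> u z1 - s" "z2 \<in> K" "u z2 - s \<le> v z2 - t"
    using quantile_superlevel[OF assms] quantile_superlevel[OF K v u t s eq[symmetric]] by auto
  have "connected ((\<lambda>z. (u z - s) - (v z - t)) ` K)"
    using K by (intro connected_continuous_image continuous_intros u v convex_connected)
      (auto simp: convex_body_def)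
  moreover have "(u z2 - s) - (v z2 - t) \<le> 0" "0 \<le> (u z1 - s) - (v z1 - t)"
    using z by auto
  ultimately have "0 \<in> (\<lambda>z. (u z - s) - (v z - t)) ` K"
    using z by (blast intro: connectedD_interval)
  then show ?thesis by force
qed

text \<open>Negligible levels make the distribution function of \<open>u\<close> continuous; it
  grows from 0 at the minimum of \<open>u\<close> to the full measure at the maximum. Asking for
  \<open>s\<close> in the image matters when \<alpha> is 0 or 1: any \<open>s\<close> below the
  minimum or above the maximum would have the right measure.\<close>

lemma quantile_exists:
  fixes K :: "'a::euclidean_space set" and u :: "'a \<Rightarrow> real"
  assumes K: "convex_body K" and u: "continuous_on K u"
    and level: "\<And>t. negligible {z\<in>K. u z = t}" and \<alpha>: "\<alpha> \<in> {0..1}"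
  shows "\<exists>s. s \<in> u ` K \<and> measure lebesgue {z\<in>K. u z \<le> s} = \<alpha> * measure lebesgue K"
proof -
  have cK: "compact K" "convex K" "K \<noteq> {}"
    using K interior_subset[of K] by (auto simp: convex_body_def)
  obtain a where a: "a \<in> K" "\<And>z. z \<in> K \<Longrightarrow> u a \<le> u z"
    using continuous_attains_inf[OF cK(1,3) u] by auto
  obtain b where b: "b \<in> K" "\<And>z. z \<in> K \<Longrightarrow> u z \<le> u b"
    using continuous_attains_sup[OF cK(1,3) u] by auto
  \<comment> \<open>Under this pushforward, negligible levels of \<open>u\<close> become the absence
    of atoms, which is continuity of \<open>cdf M\<close>.\<close>
  define M where "M = distr (lebesgue_on K) borel u"
  have Ks: "K \<in> sets lebesgue" using cK by (simp add: lmeasurable_compact fmeasurableD)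
  have um: "u \<in> borel_measurable (lebesgue_on K)"
    using continuous_imp_measurable_on_sets_lebesgue[OF u Ks] .
  have mM: "measure M A = measure lebesgue {z\<in>K. u z \<in> A}" if "A \<in> sets borel" for A
  proof -
    have "u -` A \<inter> space (lebesgue_on K) = {z\<in>K. u z \<in> A}" by auto
    then show ?thesis
      using measure_distr[OF um that] Ks unfolding M_def
      by (simp add: measure_restrict_space subset_eq)
  qed
  have "finite_measure (lebesgue_on K)"
    using cK by (simp add: finite_measure_lebesgue_on lmeasurable_compact)
  then have "finite_measure M" unfolding M_def using um by (rule finite_measure.finite_measure_distr)
  then interpret M: finite_borel_measure M
    by (simp add: finite_borel_measure_def finite_borel_measure_axioms_def M_def)
  have cdf: "cdf M t = measure lebesgue {z\<in>K. u z \<le> t}" for t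
    by (simp add: cdf_def mM)
  have null: "measure lebesgue {z\<in>K. u z = t} = 0" for t
    using level[of t] by (simp add: negligible_imp_measure0)
  have "isCont (cdf M) t" for t
    using null[of t] by (simp add: M.isCont_cdf mM)
  then have "continuous_on {u a..u b} (cdf M)" by (simp add: continuous_at_imp_continuous_on)
  moreover have "{z\<in>K. u z \<le> u a} = {z\<in>K. u z = u a}" using a by (auto intro: antisym)
  then have "cdf M (u a) \<le> \<alpha> * measure lebesgue K" using null[of "u a"] \<alpha> by (simp add: cdf)
  moreover have "{z\<in>K. u z \<le> u b} = K" using b by auto
  then have "\<alpha> * measure lebesgue K \<le> cdf M (u b)"
    using \<alpha> by (simp add: cdf mult_left_le_one_le)
  ultimately obtain s where s: "u a \<le> s" "s \<le> u b" "cdf M s = \<alpha> * measure lebesgue K"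
    using IVT'[of "cdf M" "u a" "\<alpha> * measure lebesgue K" "u b"] a b by auto
  have "connected (u ` K)" by (intro connected_continuous_image u convex_connected cK)
  then have "s \<in> u ` K" using s a b by (blast intro: connectedD_interval)
  with s show ?thesis by (auto simp: cdf)
qed

section \<open>Spheres as points of a vector space\<close>

text \<open>Up to an additive constant this is the power of \<open>z\<close> with respect to a sphere centred at
  \<open>fst p / 2\<close>.\<close>

definition sphere_power :: "'a::euclidean_space \<times> real \<Rightarrow> 'a \<Rightarrow> real" where
  "sphere_power p z = z \<bullet> z - p \<bullet> (z, 1)"

lemma continuous_on_sphere_power: "continuous_on S (sphere_power p)"
  unfolding sphere_power_def by (intro continuous_intros)

lemma sphere_power_eq: "sphere_power (2 *\<^sub>R x, R - x \<bullet> x) z = (dist x z)\<^sup>2 - R"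
  by (simp add: sphere_power_def dist_norm power2_norm_eq_inner inner_diff inner_commute)

text \<open>Every \<open>p\<close> comes from a centre and a squared radius, the latter possibly
  zero or negative.\<close>

lemma sphere_power_param:
  "p = (2 *\<^sub>R (fst p /\<^sub>R 2), (snd p + (fst p /\<^sub>R 2) \<bullet> (fst p /\<^sub>R 2)) - (fst p /\<^sub>R 2) \<bullet> (fst p /\<^sub>R 2))"
  by (simp add: prod_eq_iff)

lemma negligible_sphere_power_level:
  fixes K :: "'a::euclidean_space set"
  shows "negligible {z\<in>K. sphere_power p z = t}"
proof -
  define x where "x = fst p /\<^sub>R 2"
  define R where "R = snd p + x \<bullet> x"
  have p: "p = (2 *\<^sub>R x, R - x \<bullet> x)" unfolding R_def x_def by (rule sphere_power_param)
  have "{z\<in>K. sphere_power p z = t} \<subseteq> sphere x (sqrt (R + t))"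
    unfolding p sphere_power_eq by (auto simp: sphere_def intro!: real_sqrt_unique[symmetric])
  then show ?thesis using negligible_sphere negligible_subset by blast
qed

section \<open>Well separation and affine functionals\<close>

text \<open>The d + 1 points affinely span the whole space, whereas a nonzero \<open>w\<close>
  vanishes at most on a hyperplane.\<close>

lemma vanishing_functional:
  fixes K :: "nat \<Rightarrow> 'a::euclidean_space set" and w :: "'a \<times> real"
  assumes inj: "inj_on K {1..DIM('a) + 1}"
    and sep: "well_separated (K ` {1..DIM('a) + 1})"
    and z: "\<And>i. i \<in> {1..DIM('a) + 1} \<Longrightarrow> z i \<in> K i \<and> w \<bullet> (z i, 1) = 0"
  shows "aff_dim (z ` {1..DIM('a) + 1}) = int DIM('a)" and "w = 0"
proof -
  have "z i \<in> convex hull (K i)" if "i \<in> {1..DIM('a) + 1}" for i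
    using z that hull_subset[of "K i" convex] by blast
  then have "aff_dim (affine hull (z ` {1..DIM('a) + 1})) = int (DIM('a) + 1) - 1"
    using sep inj unfolding well_separated_def by blast
  then show dim: "aff_dim (z ` {1..DIM('a) + 1}) = int DIM('a)" by simp
  have "z ` {1..DIM('a) + 1} \<subseteq> {y. fst w \<bullet> y = - snd w}"
    using z by (force simp: inner_prod_def)
  then have "affine hull (z ` {1..DIM('a) + 1}) \<subseteq> {y. fst w \<bullet> y = - snd w}"
    by (rule hull_minimal) (rule affine_hyperplane)
  moreover have "affine hull (z ` {1..DIM('a) + 1}) = UNIV"
    using dim by (simp add: aff_dim_eq_full)
  ultimately have *: "fst w \<bullet> y = - snd w" for y by blast
  from *[of 0] *[of "fst w"] show "w = 0" by (simp add: prod_eq_iff)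
qed

text \<open>Quantitative form of \<open>vanishing_functional\<close>. By homogeneity unit vectors
  suffice; if every constant \<open>1 / (n + 1)\<close> failed, the nested compact sets of bad unit
  vectors would share a point, which vanishes somewhere on each \<open>K i\<close>.\<close>

lemma functional_lower_bound:
  fixes K :: "nat \<Rightarrow> 'a::euclidean_space set"
  assumes inj: "inj_on K {1..DIM('a) + 1}"
    and sep: "well_separated (K ` {1..DIM('a) + 1})"
    and comp: "\<And>i. i \<in> {1..DIM('a) + 1} \<Longrightarrow> compact (K i)"
  shows "\<exists>c>0. \<forall>w :: 'a \<times> real. \<exists>i\<in>{1..DIM('a) + 1}. \<forall>z\<in>K i. c * norm w \<le> \<bar>w \<bullet> (z, 1)\<bar>"
proof -
  let ?I = "{1..DIM('a) + 1}"
  \<comment> \<open>\<open>G n i\<close> holds the unit vectors that violate or just attain the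
    bound \<open>1 / (n + 1)\<close> on \<open>K i\<close>; it is compact as a projection of a
    compact set.\<close>
  define G where "G n i = fst ` ((sphere (0::'a\<times>real) 1 \<times> K i) \<inter>
     (\<lambda>(w, z). \<bar>w \<bullet> (z, 1)\<bar>) -` {..1 / real (Suc n)})" for n i
  define W where "W n = (\<Inter>i\<in>?I. G n i)" for n
  have cG: "compact (G n i)" if "i \<in> ?I" for n i
  proof -
    have c: "compact (sphere (0::'a\<times>real) 1 \<times> K i)" using comp[OF that] by (intro compact_Times) auto
    have "closed ((sphere (0::'a\<times>real) 1 \<times> K i) \<inter> (\<lambda>(w, z). \<bar>w \<bullet> (z, 1)\<bar>) -` {..1 / real (Suc n)})"
      using compact_imp_closed[OF c]
      by (intro continuous_closed_preimage) (auto simp: case_prod_unfold intro!: continuous_intros)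
    then have "compact ((sphere (0::'a\<times>real) 1 \<times> K i) \<inter> (\<lambda>(w, z). \<bar>w \<bullet> (z, 1)\<bar>) -` {..1 / real (Suc n)})"
      using compact_Int_closed[OF c] by (metis Int_left_absorb)
    then show ?thesis unfolding G_def
      by (rule compact_continuous_image[rotated]) (intro continuous_intros)
  qed
  have G_iff: "w \<in> G n i \<longleftrightarrow> norm w = 1 \<and> (\<exists>z\<in>K i. \<bar>w \<bullet> (z, 1)\<bar> \<le> 1 / real (Suc n))" for w n i
    unfolding G_def by force
  have "\<exists>n. W n = {}"
  proof (rule ccontr)
    assume "\<not> ?thesis"
    then have ne: "W n \<noteq> {}" for n by auto
    have cW: "compact (W n)" for n
    proof -
      have "closed (W n)" unfolding W_def using cG by (intro closed_INT) (auto intro: compact_imp_closed)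
      then have "compact (G n 1 \<inter> W n)" using cG[of 1] by (intro compact_Int_closed) auto
      moreover have "G n 1 \<inter> W n = W n" by (auto simp: W_def)
      ultimately show ?thesis by simp
    qed
    have mono: "W n \<subseteq> W m" if "m \<le> n" for m n
    proof -
      have le: "1 / real (Suc n) \<le> 1 / real (Suc m)" using that by (simp add: frac_le)
      have "G n i \<subseteq> G m i" for i
        by (rule subsetI) (unfold G_iff, blast intro: order_trans[OF _ le])
      then show ?thesis unfolding W_def by blast
    qed
    have "\<Inter>(range W) \<noteq> {}" by (rule compact_nest[OF cW ne mono])
    then obtain w where "w \<in> \<Inter>(range W)" unfolding ex_in_conv[symmetric] by (rule exE)
    then have w: "w \<in> W n" for n by auto
    have "\<exists>z\<in>K i. w \<bullet> (z, 1) = 0" if i: "i \<in> ?I" for i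
    proof -
      have *: "\<exists>z\<in>K i. \<bar>w \<bullet> (z, 1)\<bar> \<le> 1 / real (Suc n)" for n
        using w[of n] i by (auto simp: W_def G_iff)
      then have "K i \<noteq> {}" by auto
      then obtain z where z: "z \<in> K i" "\<forall>y\<in>K i. \<bar>w \<bullet> (z, 1)\<bar> \<le> \<bar>w \<bullet> (y, 1)\<bar>"
      proof (rule bexE[OF continuous_attains_inf[OF comp[OF i], of "\<lambda>z. \<bar>w \<bullet> (z, 1)\<bar>"]])
        show "continuous_on (K i) (\<lambda>z. \<bar>w \<bullet> (z, 1)\<bar>)" by (intro continuous_intros)
      qed auto
      have "\<bar>w \<bullet> (z, 1)\<bar> \<le> 1 / real (Suc n)" for n
      proof -
        obtain y where "y \<in> K i" "\<bar>w \<bullet> (y, 1)\<bar> \<le> 1 / real (Suc n)" using * by blast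
        then show ?thesis using z(2) by fastforce
      qed
      then have "\<not> 0 < \<bar>w \<bullet> (z, 1)\<bar>"
        by (metis inverse_eq_divide not_less reals_Archimedean)
      then show ?thesis using z(1) by auto
    qed
    then obtain z where "\<And>i. i \<in> ?I \<Longrightarrow> z i \<in> K i \<and> w \<bullet> (z i, 1) = 0" by metis
    then have "w = 0" by (rule vanishing_functional(2)[OF inj sep])
    moreover have "norm w = 1" using w[of 0] by (auto simp: W_def G_iff)
    ultimately show False by simp
  qed
  then obtain n where n: "W n = {}" by blast
  show ?thesis
  proof (intro exI conjI allI)
    show "0 < 1 / real (Suc n)" by simp
    fix w :: "'a \<times> real"
    show "\<exists>i\<in>?I. \<forall>z\<in>K i. 1 / real (Suc n) * norm w \<le> \<bar>w \<bullet> (z, 1)\<bar>"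
    proof (cases "w = 0")
      case True
      then show ?thesis by (auto intro!: bexI[of _ 1])
    next
      case False
      \<comment> \<open>The unit vector \<open>sgn w\<close> satisfies the bound for some
        \<open>i\<close>; multiplying by \<open>norm w\<close> gives it for
        \<open>w\<close>.\<close>
      have "sgn w \<notin> W n" using n by auto
      then obtain i where i: "i \<in> ?I" "sgn w \<notin> G n i" by (auto simp: W_def)
      have "1 / real (Suc n) * norm w \<le> \<bar>w \<bullet> (z, 1)\<bar>" if "z \<in> K i" for z
      proof -
        have "1 / real (Suc n) \<le> \<bar>sgn w \<bullet> (z, 1)\<bar>"
          using i(2) that False by (force simp: G_iff norm_sgn)
        also have "\<dots> = \<bar>w \<bullet> (z, 1)\<bar> / norm w"
          by (simp add: sgn_div_norm abs_mult divide_inverse mult.commute)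
        finally show ?thesis using False by (simp add: le_divide_eq)
      qed
      with i(1) show ?thesis by blast
    qed
  qed
qed

section \<open>Surjectivity of the quantile map\<close>

text \<open>The range is open by invariance of domain, and closed because expansion pulls Cauchy
  sequences back to Cauchy sequences.\<close>

lemma expanding_imp_surj:
  fixes H :: "'a::euclidean_space \<Rightarrow> 'a"
  assumes cont: "continuous_on UNIV H" and c: "0 < c"
    and exp: "\<And>p q. c * norm (p - q) \<le> norm (H p - H q)"
  shows "surj H"
proof -
  have "inj H" using exp c by (intro injI) (metis diff_self eq_iff_diff_eq_0 mult_le_0_iff norm_le_zero_iff norm_zero not_less)
  then have "open (range H)" using invariance_of_domain[OF cont] by simp
  moreover have "closed (range H)"
  proof (rule complete_imp_closed, unfold complete_def, intro allI impI)
    fix f assume f: "(\<forall>n. f n \<in> range H) \<and> Cauchy f"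
    then have "\<forall>n. \<exists>p. f n = H p" by blast
    then obtain g where "\<forall>n. f n = H (g n)" by (rule choice[THEN exE])
    then have g: "f = H \<circ> g" by auto
    have "Cauchy g"
    proof (rule metric_CauchyI)
      fix e :: real assume "0 < e"
      then obtain N where N: "\<And>m n. m \<ge> N \<Longrightarrow> n \<ge> N \<Longrightarrow> dist (f m) (f n) < c * e"
        using f c metric_CauchyD[of f "c * e"] by auto
      have "dist (g m) (g n) < e" if "m \<ge> N" "n \<ge> N" for m n
      proof -
        have "c * dist (g m) (g n) < c * e"
          using N[OF that] exp[of "g m" "g n"] by (simp add: g dist_norm)
        then show ?thesis using c by simp
      qed
      then show "\<exists>M. \<forall>m\<ge>M. \<forall>n\<ge>M. dist (g m) (g n) < e" by blast
    qed
    then obtain p where "g \<longlonglongrightarrow> p" using Cauchy_convergent convergent_def by blast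
    then have "f \<longlonglongrightarrow> H p" unfolding g
      using cont by (simp add: continuous_on_eq_continuous_at continuous_at_sequentially)
    then show "\<exists>l\<in>range H. f \<longlonglongrightarrow> l" by blast
  qed
  ultimately show ?thesis using clopen[of "range H"] by auto
qed

text \<open>Existence in terms of \<open>p\<close>, with the sign of the squared radius still
  open.\<close>

lemma simultaneous_quantile:
  fixes K :: "nat \<Rightarrow> 'a::euclidean_space set" and \<alpha> :: "nat \<Rightarrow> real"
  assumes inj: "inj_on K {1..DIM('a) + 1}"
    and body: "\<And>i. i \<in> {1..DIM('a) + 1} \<Longrightarrow> convex_body (K i)"
    and sep: "well_separated (K ` {1..DIM('a) + 1})"
    and \<alpha>: "\<And>i. i \<in> {1..DIM('a) + 1} \<Longrightarrow> \<alpha> i \<in> {0..1}"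
  shows "\<exists>p. \<forall>i\<in>{1..DIM('a) + 1}. 0 \<in> sphere_power p ` K i \<and>
    measure lebesgue {z\<in>K i. sphere_power p z \<le> 0} = \<alpha> i * measure lebesgue (K i)"
proof -
  let ?I = "{1..DIM('a) + 1}"
  have "\<exists>s. s \<in> sphere_power p ` K i \<and>
      measure lebesgue {z\<in>K i. sphere_power p z \<le> s} = \<alpha> i * measure lebesgue (K i)"
    if "i \<in> ?I" for i p
    by (intro quantile_exists body \<alpha> that continuous_on_sphere_power negligible_sphere_power_level)
  then obtain h where h: "\<And>i p. i \<in> ?I \<Longrightarrow> h i p \<in> sphere_power p ` K i"
    and hm: "\<And>i p. i \<in> ?I \<Longrightarrow>
      measure lebesgue {z\<in>K i. sphere_power p z \<le> h i p} = \<alpha> i * measure lebesgue (K i)"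
    by metis
  \<comment> \<open>The term \<open>z \<bullet> z\<close> is common to all powers and cancels,
    leaving an affine functional.\<close>
  have cross: "\<exists>z\<in>K i. h i p - h i q = (q - p) \<bullet> (z, 1)" if i: "i \<in> ?I" for i p q
  proof -
    have "\<exists>z\<in>K i. sphere_power p z - h i p = sphere_power q z - h i q"
      using i by (intro quantile_crossing body h continuous_on_sphere_power) (simp_all add: hm)
    then show ?thesis by (force simp: sphere_power_def inner_diff_left)
  qed
  have comp: "compact (K i)" if "i \<in> ?I" for i using body[OF that] by (simp add: convex_body_def)
  obtain c where c: "0 < c"
    "\<And>w :: 'a \<times> real. \<exists>i\<in>?I. \<forall>z\<in>K i. c * norm w \<le> \<bar>w \<bullet> (z, 1)\<bar>"
    using functional_lower_bound[OF inj sep comp] by blast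
  have hc: "continuous_on UNIV (h i)" if i: "i \<in> ?I" for i
  proof -
    obtain B where B: "\<And>z. z \<in> K i \<Longrightarrow> norm z \<le> B"
      using compact_imp_bounded[OF comp[OF i]] by (auto simp: bounded_iff)
    have "dist (h i p) (h i q) \<le> (\<bar>B\<bar> + 1) * dist p q" for p q
    proof -
      obtain z where z: "z \<in> K i" "h i p - h i q = (q - p) \<bullet> (z, 1)" using cross[OF i] by blast
      have "norm (z, 1::real) \<le> norm z + norm (1::real)" by (rule norm_Pair_le)
      then have "norm (z, 1::real) \<le> \<bar>B\<bar> + 1" using B[OF z(1)] by simp
      then have "norm (q - p) * norm (z, 1::real) \<le> norm (q - p) * (\<bar>B\<bar> + 1)"
        by (intro mult_left_mono) auto
      moreover have "\<bar>(q - p) \<bullet> (z, 1)\<bar> \<le> norm (q - p) * norm (z, 1::real)"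
        by (rule Cauchy_Schwarz_ineq2)
      ultimately show ?thesis by (simp add: dist_norm z norm_minus_commute mult.commute)
    qed
    then have "(\<bar>B\<bar> + 1)-lipschitz_on UNIV (h i)" by (intro lipschitz_onI) auto
    then show ?thesis by (rule lipschitz_on_continuous_on)
  qed
  \<comment> \<open>Indexing the d + 1 quantiles by basis vectors makes \<open>H\<close> a self-map
    of \<open>'a \<times> real\<close>, as invariance of domain requires.\<close>
  have "card (Basis :: ('a \<times> real) set) = card ?I" by simp
  then obtain \<phi> where \<phi>: "bij_betw \<phi> (Basis :: ('a \<times> real) set) ?I"
    using finite_same_card_bij[of "Basis :: ('a \<times> real) set" ?I] by auto
  define H where "H p = (\<Sum>b\<in>Basis. h (\<phi> b) p *\<^sub>R b)" for p
  have \<phi>I: "\<phi> b \<in> ?I" if "b \<in> Basis" for b using \<phi> that by (auto simp: bij_betw_def)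
  have Hb: "H p \<bullet> b = h (\<phi> b) p" if "b \<in> Basis" for p b
    unfolding H_def using that by simp
  have "surj H"
  proof (rule expanding_imp_surj)
    show "continuous_on UNIV H" unfolding H_def
      by (intro continuous_on_sum continuous_on_scaleR hc \<phi>I continuous_on_const)
    show "0 < c" by fact
    fix p q :: "'a \<times> real"
    \<comment> \<open>The bound holds on all of \<open>K i\<close>, hence also at the unspecified
      point supplied by \<open>cross\<close>.\<close>
    obtain i where i: "i \<in> ?I" "\<forall>z\<in>K i. c * norm (q - p) \<le> \<bar>(q - p) \<bullet> (z, 1)\<bar>" using c(2) by blast
    obtain b where b: "b \<in> Basis" "i = \<phi> b" using \<phi> i(1) unfolding bij_betw_def by (metis imageE)
    obtain z where z: "z \<in> K i" "h i p - h i q = (q - p) \<bullet> (z, 1)" using cross[OF i(1)] by blast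
    have "c * norm (q - p) \<le> \<bar>h i p - h i q\<bar>" using i(2) z by simp
    also have "\<dots> = \<bar>(H p - H q) \<bullet> b\<bar>" using b by (simp add: inner_diff_left Hb)
    also have "\<dots> \<le> norm (H p - H q)" using b(1) by (rule Basis_le_norm)
    finally show "c * norm (p - q) \<le> norm (H p - H q)" by (simp add: norm_minus_commute)
  qed
  then obtain p where p: "H p = 0" by (metis surjD)
  have "h i p = 0" if "i \<in> ?I" for i
  proof -
    obtain b where "b \<in> Basis" "i = \<phi> b" using \<phi> \<open>i \<in> ?I\<close> unfolding bij_betw_def by (metis imageE)
    then show ?thesis using Hb[of b p] p by simp
  qed
  then show ?thesis using h[where p = p] hm[where p = p] by (intro exI[of _ p]) auto
qed

section \<open>From quantiles back to spheres\<close>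

lemma sphere_iff_quantile:
  fixes x :: "'a::euclidean_space" and K :: "'a set"
  assumes "0 \<le> r"
  shows "sphere x r \<inter> K \<noteq> {} \<longleftrightarrow> 0 \<in> sphere_power (2 *\<^sub>R x, r\<^sup>2 - x \<bullet> x) ` K"
    and "cball x r \<inter> K = {z\<in>K. sphere_power (2 *\<^sub>R x, r\<^sup>2 - x \<bullet> x) z \<le> 0}"
proof -
  have "dist x z = r \<longleftrightarrow> (dist x z)\<^sup>2 = r\<^sup>2" "dist x z \<le> r \<longleftrightarrow> (dist x z)\<^sup>2 \<le> r\<^sup>2" for z
    using assms by (simp_all add: power2_eq_iff_nonneg power_mono_iff)
  then show "sphere x r \<inter> K \<noteq> {} \<longleftrightarrow> 0 \<in> sphere_power (2 *\<^sub>R x, r\<^sup>2 - x \<bullet> x) ` K"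
    and "cball x r \<inter> K = {z\<in>K. sphere_power (2 *\<^sub>R x, r\<^sup>2 - x \<bullet> x) z \<le> 0}"
    unfolding sphere_power_eq by (auto simp: image_iff)
qed

theorem theorem1:
  fixes K :: "nat \<Rightarrow> 'a::euclidean_space set" and \<alpha> :: "nat \<Rightarrow> real"
  assumes "inj_on K {1..DIM('a) + 1}"
    and "\<forall>i\<in>{1..DIM('a) + 1}. convex_body (K i)"
    and "well_separated (K ` {1..DIM('a) + 1})"
    and "\<forall>i\<in>{1..DIM('a) + 1}. \<alpha> i \<in> {0..1}"
  shows "\<exists>!(x, r). 0 < r \<and>
           transversal (sphere x r) (K ` {1..DIM('a) + 1}) \<and>
           (\<forall>i\<in>{1..DIM('a) + 1}.
              measure lebesgue (cball x r \<inter> K i) = \<alpha> i * measure lebesgue (K i))"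
proof -
  let ?I = "{1..DIM('a) + 1}"
  let ?Q = "\<lambda>p. \<forall>i\<in>?I. 0 \<in> sphere_power p ` K i \<and>
    measure lebesgue {z\<in>K i. sphere_power p z \<le> 0} = \<alpha> i * measure lebesgue (K i)"
  let ?P = "\<lambda>x r. 0 < r \<and> transversal (sphere x r) (K ` ?I) \<and>
    (\<forall>i\<in>?I. measure lebesgue (cball x r \<inter> K i) = \<alpha> i * measure lebesgue (K i))"
  have PQ: "?P x r \<longleftrightarrow> 0 < r \<and> ?Q (2 *\<^sub>R x, r\<^sup>2 - x \<bullet> x)" for x r
    by (cases "0 < r") (auto simp: transversal_def sphere_iff_quantile[OF less_imp_le])
  \<comment> \<open>Both quantiles are 0, so crossing makes \<open>p - q\<close> vanish at a point
    of each \<open>K i\<close>.\<close>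
  have unique: "p = q" if pq: "?Q p" "?Q q" for p q
  proof -
    have "\<exists>z\<in>K i. sphere_power p z - 0 = sphere_power q z - 0" if "i \<in> ?I" for i
      using pq that assms(2) by (intro quantile_crossing continuous_on_sphere_power) simp_all
    then have "\<exists>z\<in>K i. (p - q) \<bullet> (z, 1) = 0" if "i \<in> ?I" for i
      using that by (force simp: sphere_power_def inner_diff_left)
    then obtain z where "\<And>i. i \<in> ?I \<Longrightarrow> z i \<in> K i \<and> (p - q) \<bullet> (z i, 1) = 0" by metis
    then have "p - q = 0" by (rule vanishing_functional(2)[OF assms(1,3)])
    then show ?thesis by simp
  qed
  obtain p where p: "?Q p"
    using simultaneous_quantile[OF assms(1) _ assms(3), of \<alpha>] assms(2,4) by blast
  define x where "x = fst p /\<^sub>R 2"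
  define R where "R = snd p + x \<bullet> x"
  have px: "p = (2 *\<^sub>R x, R - x \<bullet> x)" unfolding R_def x_def by (rule sphere_power_param)
  \<comment> \<open>If \<open>R \<le> 0\<close>, the power vanishes at most at \<open>x\<close>, so
    \<open>x\<close> lies in every \<open>K i\<close>. Well separation for this constant choice
    would give a single point dimension d \<ge> 1.\<close>
  have "0 < R"
  proof (rule ccontr)
    assume R: "\<not> 0 < R"
    have "x \<in> K i" if "i \<in> ?I" for i
    proof -
      have "0 \<in> sphere_power p ` K i" using p \<open>i \<in> ?I\<close> by blast
      then obtain z where "z \<in> K i" "(dist x z)\<^sup>2 - R = 0"
        unfolding px sphere_power_eq image_iff by auto
      then have "dist x z = 0" using R zero_le_power2[of "dist x z"] by auto
      then show ?thesis using \<open>z \<in> K i\<close> by simp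
    qed
    then have "aff_dim ((\<lambda>i::nat. x) ` ?I) = int DIM('a)"
      using vanishing_functional(1)[OF assms(1,3), of "\<lambda>_. x" 0] by simp
    moreover have "(\<lambda>i::nat. x) ` ?I = {x}" by auto
    ultimately show False by simp
  qed
  then have "?P x (sqrt R)" unfolding PQ using p px by simp
  moreover have "y = x \<and> s = sqrt R" if "?P y s" for y s
  proof -
    have s: "0 < s" and "?Q (2 *\<^sub>R y, s\<^sup>2 - y \<bullet> y)" using that unfolding PQ by auto
    then have "(2 *\<^sub>R y, s\<^sup>2 - y \<bullet> y) = (2 *\<^sub>R x, R - x \<bullet> x)" using unique p px by blast
    then show ?thesis using s by (auto intro: real_sqrt_unique[symmetric])
  qed
  ultimately show ?thesis by (intro ex1I[of _ "(x, sqrt R)"]) auto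
qed

end
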